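(* For every nonnegative integer $n$, the cardinality of $\mathcal{IC}([3]\times[n])$ is $$\frac{n^{6}+9 n^{5}+61 n^{4}+159 n^{3}+370 n^{2}+264 n +144}{144}.$$
   Context: For a finite poset $P$, a subset $I\subseteq P$ is an interval-closed set if for all $a,b\in I$ and $z\in P$ with $a<z<b$ we have $z\in I$; $\mathcal{IC}(P)$ is the set of all interval-closed sets of $P$ (including the empty set). $[3]\times[n]=\{(i,j): 1\le i\le 3,\ 1\le j\le n\}$ is ordered componentwise: $(a,b)\le(c,d)$ iff $a\le c$ and $b\le d$ (the empty poset when $n=0$). *)

theory Defs
  imports Complex_Main "HOL-Library.Product_Order"
begin

definition interval_closed_sets :: "'a::order set \<Rightarrow> 'a set set" where
  "interval_closed_sets P =
     {I. I \<subseteq> P \<and> (\<forall>a\<in>I. \<forall>b\<in>I. \<forall>z\<in>P. a < z \<and> z < b \<longrightarrow> z \<in> I)}"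

text \<open>The order on pairs is the componentwise one of \<^theory>\<open>HOL-Library.Product_Order\<close>.\<close>

definition chain_product :: "nat \<Rightarrow> nat \<Rightarrow> (nat \<times> nat) set" where
  "chain_product m n = {1..m} \<times> {1..n}"

end

theory Submission
  imports Defs
begin

text \<open>
An interval-closed set of $[3]\times[n]$ is determined by its three rows, each of which is an
interval of $[n]$, possibly empty. For two nonempty rows $[a,b]$ above $[c,d]$ (the row with the
smaller first coordinate is the upper one), interval-closedness amounts to $c \le a$ and
$d \le b$ (\<open>compatible_atLeastAtMost\<close>): lower rows lean to the left. The count is organised by the
middle row.

If the middle row is a nonempty interval $[p,q]$, then the upper and the lower row can be chosen
independently: once both are compatible with $[p,q]$, every condition that relates the upper
row to the lower row follows. The lower row is empty or one of $p(2q-p+1)/2$ intervals,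
the upper row is empty or one of $(n+1-q)(n+2-2p+q)/2$ intervals, and the number of choices is
the product (\<open>card_outer_rows_interval\<close>).

If the middle row is empty, an element of the upper row may never lie weakly to the left of an
element of the lower row, since the elements between them in the middle row are missing. So the lower
row lies strictly to the left of the upper one. If the upper row is empty, there are
$1 + n(n+1)/2$ lower rows; if it is $[a,b]$, there are $1 + a(a-1)/2$ (\<open>card_outer_rows_empty\<close>).

Summing over the middle row (\<open>card_interval_closed_sets_middle_row\<close>) leaves a single and a double
sum of polynomials. Both are evaluated by exhibiting discrete antiderivatives.
\<close>

section \<open>Intervals of a chain\<close>

definition intervals :: "(nat \<times> nat) set \<Rightarrow> nat set set" where
  "intervals S = (\<lambda>(a, b). {a..b}) ` S"

lemma card_intervals:
  assumes "\<And>a b. (a, b) \<in> S \<Longrightarrow> a \<le> b"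
  shows "card (intervals S) = card S"
  unfolding intervals_def
  by (rule card_image) (use assms in \<open>auto simp: inj_on_def\<close>)

text \<open>
The endpoints $(c,d)$ of the nonempty intervals that can lie in the row below $[p,q]$.
With $p = q = n$ these are all nonempty intervals of $[n]$.
\<close>

definition below :: "nat \<Rightarrow> nat \<Rightarrow> (nat \<times> nat) set" where
  "below p q = {(c, d). 1 \<le> c \<and> c \<le> d \<and> c \<le> p \<and> d \<le> q}"

text \<open>
The endpoints $(a,b)$ of the nonempty intervals of $[n]$ that can lie in the row above $[p,q]$.
\<close>

definition above :: "nat \<Rightarrow> nat \<Rightarrow> nat \<Rightarrow> (nat \<times> nat) set" where
  "above n p q = {(a, b). p \<le> a \<and> a \<le> b \<and> q \<le> b \<and> b \<le> n}"

definition rows :: "nat \<Rightarrow> nat set set" where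
  "rows n = insert {} (intervals (below n n))"

lemma intervalsI: "(a, b) \<in> S \<Longrightarrow> {a..b} \<in> intervals S"
  by (force simp: intervals_def)

lemma finite_below: "finite (below p q)"
  by (rule finite_subset[of _ "{..q} \<times> {..q}"]) (auto simp: below_def)

lemma finite_above: "finite (above n p q)"
  by (rule finite_subset[of _ "{..n} \<times> {..n}"]) (auto simp: above_def)

text \<open>
Distinct endpoints give distinct nonempty intervals, and the empty row is one more choice.
\<close>

lemma card_insert_empty_intervals:
  assumes "finite S" and "\<And>a b. (a, b) \<in> S \<Longrightarrow> a \<le> b"
  shows "card (insert {} (intervals S)) = Suc (card S)"
proof -
  have "{} \<notin> intervals S"
    using assms(2) by (fastforce simp: intervals_def)
  moreover have "finite (intervals S)"
    using assms(1) by (simp add: intervals_def)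
  ultimately show ?thesis
    using card_intervals[OF assms(2)] by simp
qed

lemma card_below:
  assumes "p \<le> q"
  shows "real (card (below p q)) = real p * (2 * real q - real p + 1) / 2"
proof -
  \<comment> \<open>The left end is chosen first, since it is at most \<open>p \<le> q\<close> and then leaves \<open>q + 1 - c\<close> right ends.\<close>
  have "below p q = (SIGMA c:{1..p}. {c..q})"
    by (auto simp: below_def)
  then have "real (card (below p q)) = (\<Sum>c = 1..p. real (Suc q - c))"
    by simp
  also have "\<dots> = (\<Sum>c = 1..p. real q + 1 - real c)"
    using assms by (intro sum.cong) (auto simp: of_nat_diff)
  also have "\<dots> = real p * (2 * real q - real p + 1) / 2"
    by (induction p) (auto simp: field_simps)
  finally show ?thesis .
qed

lemma card_above:
  assumes "p \<le> q" "q \<le> n"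
  shows "real (card (above n p q)) =
    (real n + 1 - real q) * (real n + 2 - 2 * real p + real q) / 2"
proof -
  \<comment> \<open>Here the right end is chosen first: it is at least \<open>q \<ge> p\<close> and then leaves \<open>b + 1 - p\<close> left ends.\<close>
  have "above n p q = (\<lambda>(b, a). (a, b)) ` (SIGMA b:{q..n}. {p..b})"
    by (auto simp: above_def)
  then have "card (above n p q) = card (SIGMA b:{q..n}. {p..b})"
    by (simp add: card_image inj_on_def split_def prod_eq_iff)
  then have "real (card (above n p q)) = (\<Sum>b = q..n. real (Suc b - p))"
    by simp
  also have "\<dots> = (\<Sum>b = q..n. real b + 1 - real p)"
    using assms by (intro sum.cong) (auto simp: of_nat_diff)
  also have "\<dots> = (real n + 1 - real q) * (real n + 2 - 2 * real p + real q) / 2"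
    using assms(2) by (induction n rule: dec_induct) (auto simp: field_simps)
  finally show ?thesis .
qed

section \<open>Interval-closed sets row by row\<close>

text \<open>
The part of interval-closedness that concerns the two rows \<open>A\<close> (upper) and \<open>B\<close> (lower)
themselves: the elements between $(i,j)$ and $(i',k)$ that lie in these two rows are those with
second coordinate in $[j,k]$. Taking \<open>A = B\<close> expresses that a single row is an interval.
\<close>

definition compatible :: "nat set \<Rightarrow> nat set \<Rightarrow> bool" where
  "compatible A B \<longleftrightarrow> (\<forall>j\<in>A. \<forall>k\<in>B. j \<le> k \<longrightarrow> {j..k} \<subseteq> A \<inter> B)"

lemma compatible_empty [simp]: "compatible {} B" "compatible A {}"
  by (auto simp: compatible_def)

text \<open>
If $a \le d$, then $a$ and $d$ are endpoints of a segment that must lie in both rows, which gives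
$c \le a$ and $d \le b$. If $d < a$, compatibility is vacuous, and the two inequalities hold as well.
\<close>

lemma compatible_atLeastAtMost:
  assumes "a \<le> b" "c \<le> d"
  shows "compatible {a..b} {c..d} \<longleftrightarrow> c \<le> a \<and> d \<le> b"
proof
  assume *: "compatible {a..b} {c..d}"
  show "c \<le> a \<and> d \<le> b"
  proof (cases "a \<le> d")
    case True
    moreover have "a \<in> {a..b}" "d \<in> {c..d}"
      using assms by simp_all
    ultimately have "{a..d} \<subseteq> {a..b} \<inter> {c..d}"
      using * unfolding compatible_def by blast
    then show ?thesis
      using True by auto
  qed (use assms in auto)
next
  assume "c \<le> a \<and> d \<le> b"
  then have "{j..k} \<subseteq> {a..b} \<inter> {c..d}" if "j \<in> {a..b}" "k \<in> {c..d}" for j k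
    using that by auto
  then show "compatible {a..b} {c..d}"
    unfolding compatible_def by blast
qed

lemma mem_rows_iff: "A \<in> rows n \<longleftrightarrow> A \<subseteq> {1..n} \<and> compatible A A"
proof
  assume "A \<in> rows n"
  then show "A \<subseteq> {1..n} \<and> compatible A A"
    by (auto simp: rows_def intervals_def below_def compatible_atLeastAtMost)
next
  assume *: "A \<subseteq> {1..n} \<and> compatible A A"
  show "A \<in> rows n"
  proof (cases "A = {}")
    case False
    have fin: "finite A" using * finite_subset by blast
    define a b where "a = Min A" and "b = Max A"
    have ab: "a \<in> A" "b \<in> A" and bounds: "A \<subseteq> {a..b}"
      using fin False by (auto simp: a_def b_def)
    then have "a \<le> b" by auto
    then have "{a..b} \<subseteq> A"
      using * ab by (simp add: compatible_def)
    with bounds have "A = {a..b}" by simp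
    moreover have "(a, b) \<in> below n n"
      using * ab \<open>a \<le> b\<close> by (auto simp: below_def)
    ultimately show ?thesis
      by (simp add: rows_def intervalsI)
  qed (simp add: rows_def)
qed

definition stack :: "nat set \<Rightarrow> nat set \<Rightarrow> nat set \<Rightarrow> (nat \<times> nat) set" where
  "stack A B C = {1} \<times> A \<union> {2} \<times> B \<union> {3} \<times> C"

lemma mem_stack:
  "(1, j) \<in> stack A B C \<longleftrightarrow> j \<in> A"
  "(2, j) \<in> stack A B C \<longleftrightarrow> j \<in> B"
  "(3, j) \<in> stack A B C \<longleftrightarrow> j \<in> C"
  by (auto simp: stack_def)

lemma stack_rows:
  "stack A B C `` {1} = A" "stack A B C `` {2} = B" "stack A B C `` {3} = C"
  by (auto simp: stack_def)

lemma stack_of_rows: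
  assumes "I \<subseteq> chain_product 3 n"
  shows "stack (I `` {1}) (I `` {2}) (I `` {3}) = I"
proof -
  have "i = 1 \<or> i = 2 \<or> i = 3" if "(i, j) \<in> I" for i j
    using that assms by (auto simp: chain_product_def)
  then show ?thesis unfolding stack_def by force
qed

text \<open>
The elements between $(i,j)$ and $(i',k)$ are the $(l,x)$ with $i \le l \le i'$ and $j \le x \le k$, so
interval-closedness is a family of conditions on rows. The order may be taken weakly
because the two endpoints are in the set anyway.
\<close>

lemma interval_closed_chain_product_iff:
  "I \<in> interval_closed_sets (chain_product m n) \<longleftrightarrow>
     I \<subseteq> chain_product m n \<and>
     (\<forall>i l i' j k. (i, j) \<in> I \<and> (i', k) \<in> I \<and> i \<le> l \<and> l \<le> i' \<and> j \<le> k
       \<longrightarrow> {j..k} \<subseteq> I `` {l})"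
  (is "?L \<longleftrightarrow> ?S \<and> ?R")
proof
  assume L: ?L
  then have S: ?S by (simp add: interval_closed_sets_def)
  moreover have ?R
  proof (intro allI impI subsetI)
    fix i l i' j k x
    assume H: "(i, j) \<in> I \<and> (i', k) \<in> I \<and> i \<le> l \<and> l \<le> i' \<and> j \<le> k" and x: "x \<in> {j..k}"
    have "(i, j) \<in> chain_product m n" "(i', k) \<in> chain_product m n"
      using H S by auto
    then have P: "(l, x) \<in> chain_product m n"
      using H x by (auto simp: chain_product_def)
    have le: "(i, j) \<le> (l, x)" "(l, x) \<le> (i', k)"
      using H x by auto
    have "(l, x) \<in> I" if "(i, j) < (l, x)" "(l, x) < (i', k)"
      using L H P that unfolding interval_closed_sets_def by blast
    moreover have "(l, x) = (i, j) \<or> (l, x) = (i', k)"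
      if "\<not> ((i, j) < (l, x) \<and> (l, x) < (i', k))"
      using le that unfolding order.strict_iff_order by argo
    ultimately consider "(l, x) \<in> I" | "(l, x) = (i, j)" | "(l, x) = (i', k)"
      by blast
    then have "(l, x) \<in> I"
      using H by cases simp_all
    then show "x \<in> I `` {l}" by simp
  qed
  ultimately show "?S \<and> ?R" ..
next
  assume *: "?S \<and> ?R"
  have "z \<in> I" if "a \<in> I" "b \<in> I" "a < z" "z < b" for a b z
  proof -
    have le: "fst a \<le> fst z" "fst z \<le> fst b" "snd a \<le> snd z" "snd z \<le> snd b"
      using that(3,4) by (simp_all add: less_prod_def less_eq_prod_def)
    have "(fst a, snd a) \<in> I" "(fst b, snd b) \<in> I"
      using that(1,2) by simp_all
    then have "{snd a..snd b} \<subseteq> I `` {fst z}"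
      using * le order_trans[OF le(3,4)] by blast
    then have "snd z \<in> I `` {fst z}"
      using le by auto
    then show ?thesis by simp
  qed
  then show ?L using * unfolding interval_closed_sets_def by blast
qed

text \<open>
Ten triples $i \le l \le i'$ of row indices occur. The three constant ones say that the rows are
intervals, six more form the compatibility of the pairs of rows, and $1 \le 2 \le 3$ gives the
last condition.
\<close>

lemma interval_closed_stack_iff:
  "stack A B C \<in> interval_closed_sets (chain_product 3 n) \<longleftrightarrow>
     A \<in> rows n \<and> B \<in> rows n \<and> C \<in> rows n \<and>
     compatible A B \<and> compatible B C \<and> compatible A C \<and>
     (\<forall>j\<in>A. \<forall>k\<in>C. j \<le> k \<longrightarrow> {j..k} \<subseteq> B)"
  (is "?L \<longleftrightarrow> ?R")
proof
  let ?I = "stack A B C"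
  assume L: ?L
  have sub: "A \<subseteq> {1..n}" "B \<subseteq> {1..n}" "C \<subseteq> {1..n}"
    using L unfolding interval_closed_chain_product_iff
    by (auto simp: stack_def chain_product_def)
  have R: "{j..k} \<subseteq> ?I `` {l}"
    if "i \<le> l" "l \<le> i'" "(i, j) \<in> ?I" "(i', k) \<in> ?I" "j \<le> k" for i l i' j k
    using L that unfolding interval_closed_chain_product_iff by blast
  note R = R[of 1 1 1] R[of 2 2 2] R[of 3 3 3] R[of 1 1 2] R[of 1 2 2]
    R[of 2 2 3] R[of 2 3 3] R[of 1 1 3] R[of 1 2 3] R[of 1 3 3]
  \<comment> \<open>Each conjunct of the right-hand side is an instance of one of these ten facts.\<close>
  show ?R
    unfolding mem_rows_iff compatible_def Int_subset_iff
    using sub by (intro conjI ballI impI) (rule R[unfolded mem_stack stack_rows] | simp | assumption)+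
next
  let ?I = "stack A B C"
  assume R: ?R
  have "?I \<subseteq> chain_product 3 n"
    using R unfolding mem_rows_iff by (auto simp: stack_def chain_product_def)
  moreover have "{j..k} \<subseteq> ?I `` {l}"
    if "i \<le> l" "l \<le> i'" "(i, j) \<in> ?I" "(i', k) \<in> ?I" "j \<le> k" for i l i' j k
  proof -
    have "i = 1 \<or> i = 2 \<or> i = 3" "i' = 1 \<or> i' = 2 \<or> i' = 3"
      using that by (auto simp: stack_def)
    moreover from this have "l = 1 \<or> l = 2 \<or> l = 3"
      using that by auto
    ultimately show ?thesis
      using that R unfolding mem_rows_iff compatible_def
      by (elim disjE; simp add: mem_stack stack_rows del: One_nat_def)
  qed
  ultimately show ?L
    unfolding interval_closed_chain_product_iff by blast
qed

definition outer_rows :: "nat \<Rightarrow> nat set \<Rightarrow> (nat set \<times> nat set) set" where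
  "outer_rows n B = {(A, C). stack A B C \<in> interval_closed_sets (chain_product 3 n)}"

lemma finite_rows: "finite (rows n)"
  by (simp add: rows_def intervals_def finite_below)

lemma card_interval_closed_sets_middle_row:
  "card (interval_closed_sets (chain_product 3 n)) =
     (\<Sum>B\<in>rows n. card (outer_rows n B))"
proof -
  have fin: "finite (outer_rows n B)" for B
    by (rule finite_subset[of _ "rows n \<times> rows n"])
      (auto simp: outer_rows_def interval_closed_stack_iff finite_rows)
  let ?f = "\<lambda>I :: (nat \<times> nat) set. (I `` {2}, I `` {1}, I `` {3})"
  let ?g = "\<lambda>(B, A, C). stack A B C"
  have sub: "I \<subseteq> chain_product 3 n" if "I \<in> interval_closed_sets (chain_product 3 n)" for I
    using that by (simp add: interval_closed_sets_def)
  have gf: "stack (I `` {1}) (I `` {2}) (I `` {3}) = I"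
    if "I \<in> interval_closed_sets (chain_product 3 n)" for I
    using stack_of_rows[OF sub[OF that]] .
  have "bij_betw ?f (interval_closed_sets (chain_product 3 n)) (Sigma (rows n) (outer_rows n))"
  proof (rule bij_betw_byWitness[of _ ?g])
    show "\<forall>I\<in>interval_closed_sets (chain_product 3 n). ?g (?f I) = I"
      using gf by simp
    show "\<forall>t\<in>Sigma (rows n) (outer_rows n). ?f (?g t) = t"
      by (auto simp: mem_stack simp del: One_nat_def)
    show "?f ` interval_closed_sets (chain_product 3 n) \<subseteq> Sigma (rows n) (outer_rows n)"
    proof (rule image_subsetI)
      fix I assume I: "I \<in> interval_closed_sets (chain_product 3 n)"
      then have "stack (I `` {1}) (I `` {2}) (I `` {3}) \<in> interval_closed_sets (chain_product 3 n)"
        by (simp only: gf)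
      then show "?f I \<in> Sigma (rows n) (outer_rows n)"
        unfolding outer_rows_def using interval_closed_stack_iff by auto
    qed
    show "?g ` Sigma (rows n) (outer_rows n) \<subseteq> interval_closed_sets (chain_product 3 n)"
      by (auto simp: outer_rows_def)
  qed
  then have "card (interval_closed_sets (chain_product 3 n)) = card (Sigma (rows n) (outer_rows n))"
    by (rule bij_betw_same_card)
  then show ?thesis
    using fin finite_rows by simp
qed

lemma empty_in_rows: "{} \<in> rows n"
  by (simp add: rows_def)

lemma rows_cases:
  assumes "A \<in> rows n"
  obtains "A = {}" | a b where "A = {a..b}" "1 \<le> a" "a \<le> b" "b \<le> n"
  using assms by (auto simp: rows_def intervals_def below_def)

lemma atLeastAtMost_in_rows: "1 \<le> a \<Longrightarrow> a \<le> b \<Longrightarrow> b \<le> n \<Longrightarrow> {a..b} \<in> rows n"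
  by (auto simp: rows_def below_def intro!: intervalsI)

text \<open>
The upper and the lower row do not constrain each other: if $[a,b]$, $[p,q]$, $[c,d]$ satisfy
$c \le p \le a$ and $d \le q \le b$, then $c \le a$ and $d \le b$, and any
$a \le j \le k \le d$ satisfy $[j,k] \subseteq [p,q]$.
\<close>

lemma card_outer_rows_interval:
  assumes "1 \<le> p" "p \<le> q" "q \<le> n"
  shows "card (outer_rows n {p..q}) = Suc (card (above n p q)) * Suc (card (below p q))"
proof -
  let ?U = "insert {} (intervals (above n p q))" and ?D = "insert {} (intervals (below p q))"
  have up: "A \<in> ?U \<longleftrightarrow> A \<in> rows n \<and> compatible A {p..q}" for A
  proof
    assume "A \<in> ?U"
    then show "A \<in> rows n \<and> compatible A {p..q}"
      using assms
      by (auto simp: intervals_def above_def compatible_atLeastAtMost empty_in_rows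
          intro!: atLeastAtMost_in_rows)
  next
    assume *: "A \<in> rows n \<and> compatible A {p..q}"
    then have "A \<in> rows n" by simp
    then show "A \<in> ?U"
      by (cases rule: rows_cases)
        (use * assms in \<open>auto simp: above_def compatible_atLeastAtMost intro!: intervalsI\<close>)
  qed
  have down: "C \<in> ?D \<longleftrightarrow> C \<in> rows n \<and> compatible {p..q} C" for C
  proof
    assume "C \<in> ?D"
    then show "C \<in> rows n \<and> compatible {p..q} C"
      using assms
      by (auto simp: intervals_def below_def compatible_atLeastAtMost empty_in_rows
          intro!: atLeastAtMost_in_rows)
  next
    assume *: "C \<in> rows n \<and> compatible {p..q} C"
    then have "C \<in> rows n" by simp
    then show "C \<in> ?D"
      by (cases rule: rows_cases)
        (use * assms in \<open>auto simp: below_def compatible_atLeastAtMost intro!: intervalsI\<close>)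
  qed
  have free: "compatible A C \<and> (\<forall>j\<in>A. \<forall>k\<in>C. j \<le> k \<longrightarrow> {j..k} \<subseteq> {p..q})"
    if "A \<in> ?U" "C \<in> ?D" for A C
    using that by (auto simp: intervals_def below_def above_def compatible_atLeastAtMost)
  have "(A, C) \<in> outer_rows n {p..q} \<longleftrightarrow> A \<in> ?U \<and> C \<in> ?D" for A C
    unfolding outer_rows_def mem_Collect_eq case_prod_conv interval_closed_stack_iff
    using up[of A] down[of C] free[of A C] atLeastAtMost_in_rows[OF assms] by argo
  then have "outer_rows n {p..q} = ?U \<times> ?D"
    by (intro set_eqI) (simp only: split_paired_all mem_Sigma_iff)
  moreover have "card ?U = Suc (card (above n p q))"
    by (rule card_insert_empty_intervals) (rule finite_above, simp add: above_def)
  moreover have "card ?D = Suc (card (below p q))"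
    by (rule card_insert_empty_intervals) (rule finite_below, simp add: below_def)
  ultimately show ?thesis
    by (simp only: card_cartesian_product)
qed

lemma card_rows: "card (rows n) = Suc (card (below n n))"
  unfolding rows_def
  by (rule card_insert_empty_intervals) (rule finite_below, simp add: below_def)

lemma sum_rows:
  fixes f :: "nat set \<Rightarrow> real"
  shows "(\<Sum>B\<in>rows n. f B) = f {} + (\<Sum>q = 1..n. \<Sum>p = 1..q. f {p..q})"
proof -
  have "{} \<notin> intervals (below n n)"
    by (auto simp: intervals_def below_def)
  then have "(\<Sum>B\<in>rows n. f B) = f {} + (\<Sum>B\<in>intervals (below n n). f B)"
    by (simp add: rows_def intervals_def finite_below)
  also have "intervals (below n n) = (\<lambda>(q, p). {p..q}) ` (SIGMA q:{1..n}. {1..q})"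
    by (force simp: intervals_def below_def)
  also have "(\<Sum>B\<in>\<dots>. f B) = (\<Sum>(q, p)\<in>(SIGMA q:{1..n}. {1..q}). f {p..q})"
    by (subst sum.reindex) (auto simp: inj_on_def split_def)
  also have "\<dots> = (\<Sum>q = 1..n. \<Sum>p = 1..q. f {p..q})"
    by (subst sum.Sigma) auto
  finally show ?thesis .
qed

text \<open>
The summand belongs to the upper rows $[a,b]$ with a given left end $a$: there are $n + 1 - a$ of
them, and the lower row is then an arbitrary interval of $[a-1]$ or empty. The first term belongs to
the empty upper row.
\<close>

lemma card_outer_rows_empty:
  "real (card (outer_rows n {})) =
     Suc (card (below n n)) + (\<Sum>a = 1..n. (real n + 1 - real a) * Suc (card (below (a - 1) (a - 1))))"
proof -
  define left where "left A = {C \<in> rows n. \<forall>j\<in>A. \<forall>k\<in>C. k < j}" for A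
  have "(A, C) \<in> outer_rows n {} \<longleftrightarrow> A \<in> rows n \<and> C \<in> left A" for A C
  proof -
    have "(\<forall>j\<in>A. \<forall>k\<in>C. j \<le> k \<longrightarrow> {j..k} \<subseteq> {}) \<longleftrightarrow> (\<forall>j\<in>A. \<forall>k\<in>C. k < j)"
      by (simp add: not_le)
    moreover have "compatible A C" if "\<forall>j\<in>A. \<forall>k\<in>C. k < j"
      using that by (meson compatible_def not_le)
    ultimately show ?thesis
      unfolding outer_rows_def left_def mem_Collect_eq case_prod_conv interval_closed_stack_iff
      using empty_in_rows[of n] compatible_empty by blast
  qed
  then have "outer_rows n {} = Sigma (rows n) left"
    by (intro set_eqI) (simp only: split_paired_all mem_Sigma_iff)
  moreover have "finite (left A)" for A
    by (simp add: left_def finite_rows)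
  ultimately have "real (card (outer_rows n {})) = (\<Sum>A\<in>rows n. real (card (left A)))"
    using finite_rows by simp
  also have "\<dots> = real (card (left {})) + (\<Sum>b = 1..n. \<Sum>a = 1..b. real (card (left {a..b})))"
    by (rule sum_rows)
  also have "left {} = rows n"
    by (simp add: left_def)
  also have "(\<Sum>b = 1..n. \<Sum>a = 1..b. real (card (left {a..b}))) =
      (\<Sum>b = 1..n. \<Sum>a = 1..b. real (card (rows (a - 1))))"
  proof (intro sum.cong refl)
    fix b a assume ba: "b \<in> {1..n}" "a \<in> {1..b}"
    have "C \<subseteq> {1..n} \<and> (\<forall>j\<in>{a..b}. \<forall>k\<in>C. k < j) \<longleftrightarrow> C \<subseteq> {1..a - 1}" for C
    proof
      assume C: "C \<subseteq> {1..n} \<and> (\<forall>j\<in>{a..b}. \<forall>k\<in>C. k < j)"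
      then have "\<forall>k\<in>C. k < a" using ba by simp
      then show "C \<subseteq> {1..a - 1}" using C by fastforce
    next
      assume "C \<subseteq> {1..a - 1}"
      then have "1 \<le> k \<and> k < a" if "k \<in> C" for k
        using that ba by fastforce
      then show "C \<subseteq> {1..n} \<and> (\<forall>j\<in>{a..b}. \<forall>k\<in>C. k < j)"
        using ba by fastforce
    qed
    then have "left {a..b} = rows (a - 1)"
      unfolding left_def mem_rows_iff set_eq_iff mem_Collect_eq by blast
    then show "real (card (left {a..b})) = real (card (rows (a - 1)))" by simp
  qed
  also have "\<dots> = (\<Sum>a = 1..n. \<Sum>b = a..n. real (card (rows (a - 1))))"
    by (subst sum.Sigma, simp, simp)
      (subst sum.Sigma, simp, simp,
       rule sum.reindex_bij_witness[of _ "\<lambda>(a, b). (b, a)" "\<lambda>(b, a). (a, b)"], auto)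
  also have "\<dots> = (\<Sum>a = 1..n. (real n + 1 - real a) * real (card (rows (a - 1))))"
    by (intro sum.cong) (auto simp: of_nat_diff)
  finally show ?thesis
    by (simp add: card_rows)
qed

section \<open>Summation\<close>

text \<open>
A sum is evaluated by a function that vanishes at $0$ and has the summand as backward difference.
With $F$ a polynomial, the hypothesis on differences is a polynomial identity over the reals.
The polynomials below are the antiderivatives obtained from the formulas for sums of powers.
\<close>

lemma sum_eq_by_differences:
  fixes f F :: "real \<Rightarrow> real"
  assumes "F 0 = 0" and "\<And>x. F (x + 1) = F x + f (x + 1)"
  shows "(\<Sum>k = 1..m. f (real k)) = F (real m)"
proof (induction m)
  case (Suc m)
  then show ?case using assms(2)[of "real m"] by (simp add: add.commute)
qed (simp add: assms(1))

text \<open>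
For $m \le n$, the number of interval-closed sets with empty middle row whose upper row is nonempty
with left end at most $m$: the lower row lies to the left of that end.
\<close>

definition disjoint_pairs_poly :: "real \<Rightarrow> real \<Rightarrow> real" where
  "disjoint_pairs_poly n m = (20 * m * n + 10 * m - 9 * m^2 + 2 * m^3 + 4 * m^3 * n - 3 * m^4) / 24"

lemma sum_disjoint_pairs:
  "(\<Sum>a = 1..m. (n + 1 - real a) * (1 + (real a - 1) * real a / 2)) = disjoint_pairs_poly n (real m)"
  by (rule sum_eq_by_differences)
    (simp_all add: disjoint_pairs_poly_def field_simps eval_nat_numeral)

text \<open>
For $m \le q \le n$, the number of interval-closed sets whose middle row is $[p,q]$ for some $p \le m$. The right end $q$
is a parameter separate from $m$, so that the sum over $p \le m$ can be done by differences; later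
$m = q$.
\<close>

definition fixed_max_poly :: "real \<Rightarrow> real \<Rightarrow> real \<Rightarrow> real" where
  "fixed_max_poly n q m =
    (- 3 * m^4 * q + 3 * m^4 * n + 3 * m^4 + 10 * m^3 * q^2 - 8 * m^3 * q * n - 8 * m^3 * q
     - 2 * m^3 * n^2 - 4 * m^3 * n - 6 * m^3 - 6 * m^2 * q^3 + 6 * m^2 * q^2
     + 6 * m^2 * q * n^2 + 6 * m^2 * q * n + 27 * m^2 * q - 15 * m^2 * n - 15 * m^2
     - 6 * m * q^3 - 16 * m * q^2 + 6 * m * q * n^2 + 14 * m * q * n + 20 * m * q
     + 14 * m * n^2 + 28 * m * n + 42 * m) / 24"

lemma sum_fixed_max:
  "(\<Sum>p = 1..m. (1 + (n + 1 - q) * (n + 2 - 2 * real p + q) / 2) *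
      (1 + real p * (2 * q - real p + 1) / 2)) = fixed_max_poly n q (real m)"
  by (rule sum_eq_by_differences)
    (simp_all add: fixed_max_poly_def field_simps eval_nat_numeral)

text \<open>
The same for all nonempty middle rows $[p,q]$ with $q \le m$, where $m \le n$. Here $m$ is kept apart from $n$ because the
summand also depends on $n$; later $m = n$.
\<close>

definition middle_row_poly :: "real \<Rightarrow> real \<Rightarrow> real" where
  "middle_row_poly n m =
    (m^6 - 6 * m^5 * n - 3 * m^5 + 6 * m^4 * n^2 - 12 * m^4 * n - 5 * m^4 + 24 * m^3 * n^2
     - 6 * m^3 * n + 15 * m^3 + 66 * m^2 * n^2 + 84 * m^2 * n + 148 * m^2 + 48 * m * n^2
     + 84 * m * n + 132 * m) / 144"

lemma sum_middle_row:
  "(\<Sum>q = 1..m. fixed_max_poly n (real q) (real q)) = middle_row_poly n (real m)"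
  by (rule sum_eq_by_differences[where f = "\<lambda>q. fixed_max_poly n q q"])
    (simp_all add: middle_row_poly_def fixed_max_poly_def field_simps eval_nat_numeral)

theorem corollary3p6:
  fixes n :: nat
  shows "real (card (interval_closed_sets (chain_product 3 n))) =
    (real n ^ 6 + 9 * real n ^ 5 + 61 * real n ^ 4 + 159 * real n ^ 3
      + 370 * real n ^ 2 + 264 * real n + 144) / 144"
proof -
  let ?L = "\<lambda>p q. real p * (2 * real q - real p + 1) / 2"
  let ?U = "\<lambda>p q. (real n + 1 - real q) * (real n + 2 - 2 * real p + real q) / 2"
  have "(\<Sum>a = 1..n. (real n + 1 - real a) * Suc (card (below (a - 1) (a - 1)))) =
      (\<Sum>a = 1..n. (real n + 1 - real a) * (1 + (real a - 1) * real a / 2))"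
    by (intro sum.cong refl) (simp add: card_below of_nat_diff)
  then have empty: "real (card (outer_rows n {})) =
      1 + real n * (real n + 1) / 2 + disjoint_pairs_poly (real n) (real n)"
    unfolding card_outer_rows_empty sum_disjoint_pairs by (simp add: card_below)
  have "(\<Sum>q = 1..n. \<Sum>p = 1..q. real (card (outer_rows n {p..q}))) =
      (\<Sum>q = 1..n. \<Sum>p = 1..q. (1 + ?U p q) * (1 + ?L p q))"
    by (intro sum.cong refl)
      (simp only: card_outer_rows_interval atLeastAtMost_iff of_nat_mult of_nat_Suc card_above card_below)
  also have "\<dots> = middle_row_poly (real n) (real n)"
    by (simp only: sum_fixed_max sum_middle_row)
  finally have nonempty: "(\<Sum>q = 1..n. \<Sum>p = 1..q. real (card (outer_rows n {p..q}))) =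
      middle_row_poly (real n) (real n)" .
  have "real (card (interval_closed_sets (chain_product 3 n))) =
      real (card (outer_rows n {})) + (\<Sum>q = 1..n. \<Sum>p = 1..q. real (card (outer_rows n {p..q})))"
    unfolding card_interval_closed_sets_middle_row of_nat_sum by (rule sum_rows)
  then show ?thesis
    unfolding empty nonempty
    by (simp add: disjoint_pairs_poly_def middle_row_poly_def field_simps eval_nat_numeral)
qed

end
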